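(* Let $v,k$ be integers with $4\leq k\leq v-4$. If $G$ and $G'$ are two graphs on the same set $V$ of $v$ vertices which are $k$-hypomorphic up to complementation, then $G'=G$ or $G'=\overline G$.
   Context: A graph is a pair $G=(V,E)$ with $E$ a set of 2-element subsets of $V$; $\overline G$ denotes its complement and $G_{\restriction K}$ the subgraph induced on $K\subseteq V$. Two graphs are isomorphic up to complementation if one is isomorphic to the other or to its complement. $G,G'$ on $V$ are $k$-hypomorphic up to complementation if for every $k$-element $K\subseteq V$, $G_{\restriction K}$ and $G'_{\restriction K}$ are isomorphic up to complementation. *)

theory Defs
  imports Main "HOL-Library.Ramsey"
begin

text \<open>
  A simple undirected graph is a pair of a vertex set and an edge set.  The 2-element
  subsets of \<open>V\<close> form the set \<open>nsets V 2\<close> of \<^theory>\<open>HOL-Library.Ramsey\<close>.  The type also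
  contains pairs that are not graphs; these are excluded by \<open>is_graph\<close>.
\<close>

type_synonym 'a graph = "'a set \<times> 'a set set"

abbreviation verts :: "'a graph \<Rightarrow> 'a set" where
  "verts G \<equiv> fst G"

abbreviation edges :: "'a graph \<Rightarrow> 'a set set" where
  "edges G \<equiv> snd G"

definition is_graph :: "'a graph \<Rightarrow> bool" where
  "is_graph G \<longleftrightarrow> edges G \<subseteq> nsets (verts G) 2"

definition complement :: "'a graph \<Rightarrow> 'a graph" where
  "complement G = (verts G, nsets (verts G) 2 - edges G)"

definition induced :: "'a graph \<Rightarrow> 'a set \<Rightarrow> 'a graph" where
  "induced G K = (K, edges G \<inter> nsets K 2)"

definition isomorphic :: "'a graph \<Rightarrow> 'b graph \<Rightarrow> bool" where
  "isomorphic G H \<longleftrightarrow>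
     (\<exists>f. bij_betw f (verts G) (verts H) \<and>
          (\<forall>x\<in>verts G. \<forall>y\<in>verts G. {x, y} \<in> edges G \<longleftrightarrow> {f x, f y} \<in> edges H))"

definition isomorphic_upto_complement :: "'a graph \<Rightarrow> 'b graph \<Rightarrow> bool" where
  "isomorphic_upto_complement G H \<longleftrightarrow> isomorphic G H \<or> isomorphic G (complement H)"

text \<open>Only meant for graphs with the same vertex set, i.e. when \<open>verts G = verts G'\<close>.\<close>

definition hypomorphic_upto_complement :: "nat \<Rightarrow> 'a graph \<Rightarrow> 'a graph \<Rightarrow> bool" where
  "hypomorphic_upto_complement k G G' \<longleftrightarrow>
     (\<forall>K\<in>nsets (verts G) k. isomorphic_upto_complement (induced G K) (induced G' K))"

end

theory Submission
  imports Defs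
begin

text \<open>
  Among the 4-subsets of a \<open>k\<close>-set \<open>K\<close>, the number of those inducing an odd number of edges is
  invariant under isomorphism and, since 4 vertices span 6 pairs, under complementation.
  Inclusion matrices of \<open>t\<close>-subsets versus \<open>k\<close>-subsets are injective for \<open>t \<le> k \<le> v - t\<close>
  (Gottlieb), so with \<open>t = 4\<close> the two graphs have edge numbers of equal parity on every 4-set.
  Hence their symmetric difference \<open>U\<close> has an even number of edges on every 4-set. On at least
  6 vertices this forces any two disjoint pairs to agree about membership in \<open>U\<close>, and therefore
  \<open>U\<close> is empty or complete.
\<close>

section \<open>Injectivity of inclusion matrices\<close>

lemma nsets_insert_Suc:
  assumes "x \<notin> K"
  shows "nsets (insert x K) (Suc t) = nsets K (Suc t) \<union> insert x ` nsets K t"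
proof (intro equalityI subsetI)
  fix S assume S: "S \<in> nsets (insert x K) (Suc t)"
  show "S \<in> nsets K (Suc t) \<union> insert x ` nsets K t"
  proof (cases "x \<in> S")
    case True
    then have "S = insert x (S - {x})" "S - {x} \<in> nsets K t"
      using S by (auto simp: nsets_def)
    then show ?thesis by blast
  next
    case False
    with S show ?thesis by (auto simp: nsets_def)
  qed
next
  fix S assume "S \<in> nsets K (Suc t) \<union> insert x ` nsets K t"
  then show "S \<in> nsets (insert x K) (Suc t)"
  proof
    assume "S \<in> insert x ` nsets K t"
    then obtain R where "R \<in> nsets K t" "S = insert x R" by blast
    moreover from this have "x \<notin> R" using assms by (auto simp: nsets_def)
    ultimately show ?thesis by (auto simp: nsets_def)
  qed (auto simp: nsets_def)
qed

lemma sum_nsets_insert: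
  assumes "finite K" "x \<notin> K"
  shows "sum f (nsets (insert x K) (Suc t)) =
    sum f (nsets K (Suc t)) + (\<Sum>S\<in>nsets K t. f (insert x S))"
proof -
  have "inj_on (insert x) (nsets K t)"
    using assms(2) by (intro inj_onI) (metis (no_types, lifting) insert_ident nsets_def mem_Collect_eq subsetD)
  moreover have "nsets K (Suc t) \<inter> insert x ` nsets K t = {}"
    using assms(2) by (auto simp: nsets_def)
  ultimately show ?thesis
    using assms by (simp add: nsets_insert_Suc sum.union_disjoint finite_imp_finite_nsets sum.reindex o_def)
qed

text \<open>Any two subsets of size \<open>Suc t\<close> are joined by a chain of single-element
  exchanges, and each exchange preserves \<open>f\<close>. The induction measures how far
  \<open>A\<close> is from \<open>B\<close>.\<close>

lemma nsets_exchange_constant: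
  assumes exch: "\<And>x y S. x \<in> V \<Longrightarrow> y \<in> V \<Longrightarrow> x \<noteq> y \<Longrightarrow> S \<in> nsets (V - {x, y}) t \<Longrightarrow>
      f (insert x S) = f (insert y S)"
    and "A \<in> nsets V (Suc t)" "B \<in> nsets V (Suc t)"
  shows "f A = f B"
  using assms(2)
proof (induction "card (A - B)" arbitrary: A rule: less_induct)
  case less
  have fin: "finite A" "finite B" and card: "card A = Suc t" "card B = Suc t"
    and sub: "A \<subseteq> V" "B \<subseteq> V"
    using less.prems assms(3) by (auto simp: nsets_def)
  show ?case
  proof (cases "A = B")
    case False
    then obtain x y where x: "x \<in> A" "x \<notin> B" and y: "y \<in> B" "y \<notin> A"
      using fin card by (metis card_subset_eq subsetI)
    have S: "A - {x} \<in> nsets (V - {x, y}) t"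
      using x y fin card sub by (auto simp: nsets_def)
    then have "insert y (A - {x}) \<in> nsets V (Suc t)"
      using y fin card sub by (auto simp: nsets_def)
    \<comment> \<open>Trading \<open>x \<notin> B\<close> for \<open>y \<in> B\<close> removes one
      element of the difference and adds none.\<close>
    moreover have "insert y (A - {x}) - B \<subset> A - B"
      using x y by auto
    then have "card (insert y (A - {x}) - B) < card (A - B)"
      using fin by (intro psubset_card_mono) auto
    ultimately have "f (insert y (A - {x})) = f B"
      using less.hyps by blast
    moreover have "f (insert x (A - {x})) = f (insert y (A - {x}))"
      using S x y sub by (intro exch) auto
    ultimately show ?thesis
      using x by (simp add: insert_absorb)
  qed simp
qed

text \<open>Gottlieb's theorem: a vector \<open>f\<close> in the kernel is zero. By induction on
  \<open>t\<close>, the differences of \<open>f\<close> under the exchange of two points vanish, so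
  \<open>f\<close> is constant on the subsets of size \<open>t\<close>. A constant in the kernel is
  zero, since a nonzero binomial coefficient stays nonzero in characteristic 0.\<close>

lemma inclusion_matrix_injective:
  fixes f :: "'a set \<Rightarrow> 'b :: {idom, ring_char_0}"
  assumes "finite V" "t \<le> k" "k + t \<le> card V"
    and "\<And>K. K \<in> nsets V k \<Longrightarrow> sum f (nsets K t) = 0"
    and "T \<in> nsets V t"
  shows "f T = 0"
  using assms
proof (induction t arbitrary: V k f T)
  case 0
  obtain K where "K \<subseteq> V" "card K = k" "finite K"
    using obtain_subset_with_card_n[of k V] 0 by auto
  then have "sum f (nsets K 0) = 0"
    using 0 by (auto simp: nsets_def)
  moreover have "T = {}"
    using 0 by simp
  ultimately show ?case by simp
next
  case (Suc t)
  obtain j where k: "k = Suc j"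
    using Suc.prems(2) by (cases k) auto
  have exch: "f (insert x S) = f (insert y S)"
    if xy: "x \<in> V" "y \<in> V" "x \<noteq> y" and S: "S \<in> nsets (V - {x, y}) t" for x y S
  proof -
    \<comment> \<open>This is a kernel vector of the smaller instance with
      \<open>V - {x, y}\<close>, \<open>j\<close> and \<open>t\<close>. The ground set loses two
      points while \<open>k\<close> and \<open>Suc t\<close> lose one each, so both bounds are
      inherited.\<close>
    define g where "g R = f (insert x R) - f (insert y R)" for R
    have "sum g (nsets K t) = 0" if K: "K \<in> nsets (V - {x, y}) j" for K
    proof -
      have fin: "finite K" and notin: "x \<notin> K" "y \<notin> K"
        using K by (auto simp: nsets_def)
      have "insert x K \<in> nsets V k" "insert y K \<in> nsets V k"
        using K xy k fin notin by (auto simp: nsets_def)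
      then have "sum f (nsets (insert x K) (Suc t)) = sum f (nsets (insert y K) (Suc t))"
        using Suc.prems(4) by simp
      \<comment> \<open>The subsets of \<open>K\<close> itself occur in both sums and cancel; those
        through \<open>x\<close> and through \<open>y\<close> leave the sum of
        \<open>g\<close>.\<close>
      then show ?thesis
        using fin notin by (simp add: sum_nsets_insert g_def sum_subtractf)
    qed
    moreover have "card (V - {x, y}) = card V - 2"
      using xy Suc.prems(1) by (simp add: card_Diff_subset)
    ultimately have "g S = 0"
      using Suc.prems k S by (intro Suc.IH[of "V - {x, y}" j g S]) auto
    then show ?thesis by (simp add: g_def)
  qed
  have const: "f A = f T" if "A \<in> nsets V (Suc t)" for A
    using exch that Suc.prems(5) by (rule nsets_exchange_constant)
  obtain K where K: "K \<subseteq> V" "card K = k" "finite K"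
    using obtain_subset_with_card_n[of k V] Suc.prems by auto
  have "sum f (nsets K (Suc t)) = (\<Sum>A\<in>nsets K (Suc t). f T)"
    using K by (intro sum.cong const) (auto simp: nsets_def)
  also have "\<dots> = of_nat (k choose Suc t) * f T"
    using K by (simp add: card_nsets)
  finally have "of_nat (k choose Suc t) * f T = 0"
    using Suc.prems(4) K by (simp add: nsets_def)
  \<comment> \<open>The binomial coefficient is nonzero because
    \<open>Suc t \<le> k\<close>.\<close>
  then show ?case
    using Suc.prems(2) by (simp add: binomial_eq_0_iff)
qed

section \<open>The 4-sets with an odd number of edges\<close>

definition odd_quads :: "'a graph \<Rightarrow> 'a set set" where
  "odd_quads G = {T \<in> nsets (verts G) 4. odd (card (edges G \<inter> nsets T 2))}"

lemma odd_quads_complement: "odd_quads (complement G) = odd_quads G"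
proof -
  have "odd (card ((nsets (verts G) 2 - edges G) \<inter> nsets T 2)) \<longleftrightarrow> odd (card (edges G \<inter> nsets T 2))"
    if T: "T \<in> nsets (verts G) 4" for T
  proof -
    have fin: "finite (nsets T 2)"
      using T by (auto simp: nsets_def intro: finite_imp_finite_nsets)
    have "card T = 4"
      using T by (simp add: nsets_def)
    then have six: "card (nsets T 2) = 6"
      by (simp add: choose_two)
    have "(nsets (verts G) 2 - edges G) \<inter> nsets T 2 = nsets T 2 - edges G \<inter> nsets T 2"
      using T by (auto simp: nsets_def)
    then have "card ((nsets (verts G) 2 - edges G) \<inter> nsets T 2) = 6 - card (edges G \<inter> nsets T 2)"
      using fin six by (simp add: card_Diff_subset)
    \<comment> \<open>This bound keeps the natural subtraction from truncating, so that
      \<open>6 - m\<close> and \<open>m\<close> have equal parity.\<close>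
    moreover have "card (edges G \<inter> nsets T 2) \<le> 6"
      using card_mono[OF fin, of "edges G \<inter> nsets T 2"] six by simp
    ultimately show ?thesis by simp
  qed
  then show ?thesis
    by (auto simp: odd_quads_def complement_def)
qed

lemma card_induced_edges_image:
  assumes inj: "inj_on f T"
    and pres: "\<And>x y. x \<in> T \<Longrightarrow> y \<in> T \<Longrightarrow> {x, y} \<in> E \<longleftrightarrow> {f x, f y} \<in> F"
  shows "card (F \<inter> nsets (f ` T) 2) = card (E \<inter> nsets T 2)"
proof -
  have "inj_on ((`) f) (E \<inter> nsets T 2)"
    by (rule inj_on_subset[OF inj_on_image_Pow[OF inj]]) (auto simp: nsets_def)
  moreover have "(`) f ` (E \<inter> nsets T 2) = F \<inter> nsets (f ` T) 2"
  proof (intro equalityI subsetI)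
    fix e assume "e \<in> (`) f ` (E \<inter> nsets T 2)"
    then obtain x y where "x \<in> T" "y \<in> T" "x \<noteq> y" "{x, y} \<in> E" "e = {f x, f y}"
      by (auto simp: nsets_2_eq)
    then show "e \<in> F \<inter> nsets (f ` T) 2"
      using pres inj by (simp add: inj_on_eq_iff)
  next
    fix e assume "e \<in> F \<inter> nsets (f ` T) 2"
    then obtain x y where "x \<in> T" "y \<in> T" "f x \<noteq> f y" "e = f ` {x, y}" "e \<in> F"
      by (auto elim!: nsets2_E)
    then show "e \<in> (`) f ` (E \<inter> nsets T 2)"
      using pres by (intro image_eqI[of _ _ "{x, y}"]) auto
  qed
  ultimately show ?thesis by (metis card_image)
qed

lemma card_odd_quads_isomorphic:
  assumes "isomorphic G H"
  shows "card (odd_quads G) = card (odd_quads H)"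
proof -
  obtain f where bij: "bij_betw f (verts G) (verts H)"
    and pres: "\<forall>x\<in>verts G. \<forall>y\<in>verts G. {x, y} \<in> edges G \<longleftrightarrow> {f x, f y} \<in> edges H"
    using assms by (auto simp: isomorphic_def)
  have bij4: "bij_betw ((`) f) (nsets (verts G) 4) (nsets (verts H) 4)"
    using bij by (rule bij_betw_nsets)
  have "card (edges H \<inter> nsets (f ` T) 2) = card (edges G \<inter> nsets T 2)"
    if "T \<in> nsets (verts G) 4" for T
  proof (rule card_induced_edges_image)
    show "inj_on f T"
      using bij that by (auto simp: bij_betw_def nsets_def intro: inj_on_subset)
  qed (use that pres in \<open>auto simp: nsets_def\<close>)
  then have "(`) f ` odd_quads G =
      {T \<in> (`) f ` nsets (verts G) 4. odd (card (edges H \<inter> nsets T 2))}"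
    unfolding odd_quads_def by (auto intro!: imageI)
  then have "(`) f ` odd_quads G = odd_quads H"
    by (simp only: bij_betw_imp_surj_on[OF bij4] odd_quads_def)
  moreover have "inj_on ((`) f) (odd_quads G)"
    using bij4 by (auto simp: bij_betw_def odd_quads_def intro: inj_on_subset)
  ultimately show ?thesis by (metis card_image)
qed

lemma odd_quads_induced:
  assumes "K \<subseteq> verts G"
  shows "odd_quads (induced G K) = odd_quads G \<inter> nsets K 4"
proof -
  have "edges G \<inter> nsets K 2 \<inter> nsets T 2 = edges G \<inter> nsets T 2" if "T \<subseteq> K" for T
    using that by (auto simp: nsets_def)
  with assms show ?thesis
    by (auto simp: odd_quads_def induced_def nsets_def)
qed

text \<open>Hypomorphy gives both graphs equally many odd 4-sets inside each \<open>k\<close>-set,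
  so the difference of the two indicator functions is in the kernel of the inclusion matrix for
  \<open>t = 4\<close>. It takes integer values so that differences are genuine and the
  characteristic is 0.\<close>

lemma odd_quads_eq:
  assumes "finite V" "verts G = V" "verts G' = V" "4 \<le> k" "k + 4 \<le> card V"
    and hyp: "hypomorphic_upto_complement k G G'"
  shows "odd_quads G = odd_quads G'"
proof -
  define f :: "'a set \<Rightarrow> int" where
    "f T = of_bool (T \<in> odd_quads G) - of_bool (T \<in> odd_quads G')" for T
  have "sum f (nsets K 4) = 0" if K: "K \<in> nsets V k" for K
  proof -
    have KV: "K \<subseteq> V" and fin: "finite (nsets K 4)"
      using K by (auto simp: nsets_def intro: finite_imp_finite_nsets)
    \<comment> \<open>If the induced graphs are isomorphic only after complementing one of them, the
      count is still the same by \<open>odd_quads_complement\<close>.\<close>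
    have "card (odd_quads (induced G K)) = card (odd_quads (induced G' K))"
      using hyp K assms(2) card_odd_quads_isomorphic odd_quads_complement
      by (metis hypomorphic_upto_complement_def isomorphic_upto_complement_def)
    then have "card (nsets K 4 \<inter> odd_quads G) = card (nsets K 4 \<inter> odd_quads G')"
      using KV assms(2,3) by (simp add: odd_quads_induced Int_commute)
    moreover have "sum f (nsets K 4) =
        int (card (nsets K 4 \<inter> odd_quads G)) - int (card (nsets K 4 \<inter> odd_quads G'))"
      using fin by (simp add: f_def sum_subtractf sum_of_bool_eq)
    ultimately show ?thesis by simp
  qed
  then have zero: "f T = 0" if "T \<in> nsets V 4" for T
    using inclusion_matrix_injective[of V 4 k f T] assms that by blast
  have "T \<in> odd_quads G \<longleftrightarrow> T \<in> odd_quads G'" if "T \<in> nsets V 4" for T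
    using zero[OF that] by (auto simp: f_def of_bool_def split: if_splits)
  moreover have "odd_quads G \<subseteq> nsets V 4" "odd_quads G' \<subseteq> nsets V 4"
    using assms(2,3) by (auto simp: odd_quads_def)
  ultimately show ?thesis by blast
qed

section \<open>Edge sets that are even on every 4-set\<close>

lemma even_card_sym_diff_iff:
  assumes "finite A" "finite B"
  shows "even (card (sym_diff A B)) \<longleftrightarrow> (even (card A) \<longleftrightarrow> even (card B))"
proof -
  have "card A = card (A - B) + card (A \<inter> B)"
    using assms by (metis card_Diff_subset_Int card_Int_Diff add.commute)
  moreover have "card B = card (B - A) + card (A \<inter> B)"
    using assms by (metis card_Int_Diff add.commute Int_commute)
  moreover have "card (sym_diff A B) = card (A - B) + card (B - A)"
    using assms by (intro card_Un_disjoint) auto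
  ultimately show ?thesis by presburger
qed

text \<open>Spelling out the six pairs as 0/1 terms turns parity conditions on several 4-sets into
  linear relations that can be added.\<close>

lemma even_card_quad:
  assumes "distinct [a, b, c, d]" "even (card (U \<inter> nsets {a, b, c, d} 2))"
  shows "even (of_bool ({a, b} \<in> U) + of_bool ({a, c} \<in> U) + of_bool ({a, d} \<in> U)
    + of_bool ({b, c} \<in> U) + of_bool ({b, d} \<in> U) + of_bool ({c, d} \<in> U) :: nat)"
proof -
  have "nsets {a, b, c, d} 2 = {{a, b}, {a, c}, {a, d}, {b, c}, {b, d}, {c, d}}"
    using assms(1) by (auto elim!: nsets2_E simp: doubleton_eq_iff)
  then have "card (U \<inter> nsets {a, b, c, d} 2) =
      (\<Sum>e\<in>{{a, b}, {a, c}, {a, d}, {b, c}, {b, d}, {c, d}}. of_bool (e \<in> U))"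
    by (simp add: sum_of_bool_eq Int_commute)
  also have "\<dots> = of_bool ({a, b} \<in> U) + of_bool ({a, c} \<in> U) + of_bool ({a, d} \<in> U)
    + of_bool ({b, c} \<in> U) + of_bool ({b, d} \<in> U) + of_bool ({c, d} \<in> U)"
    using assms(1) by (simp add: doubleton_eq_iff)
  finally show ?thesis using assms(2) by simp
qed

text \<open>The two pairs occupy four vertices; the bound 6 provides two more, \<open>a\<close> and
  \<open>b\<close>. Each of the four pairs joining \<open>e\<close> to \<open>e'\<close> gives an
  even 4-set together with \<open>a\<close> and \<open>b\<close>, and adding these to the 4-set
  \<open>e \<union> e'\<close> isolates the two pairs modulo 2.\<close>

lemma disjoint_pairs_agree:
  assumes card: "6 \<le> card V"
    and even: "\<And>T. T \<in> nsets V 4 \<Longrightarrow> even (card (U \<inter> nsets T 2))"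
    and e: "e \<in> nsets V 2" and e': "e' \<in> nsets V 2" and disj: "e \<inter> e' = {}"
  shows "e \<in> U \<longleftrightarrow> e' \<in> U"
proof -
  obtain c d where cd: "e = {c, d}" "c \<noteq> d" "c \<in> V" "d \<in> V"
    using e by (auto simp: nsets_2_eq)
  obtain p q where pq: "e' = {p, q}" "p \<noteq> q" "p \<in> V" "q \<in> V"
    using e' by (auto simp: nsets_2_eq)
  have "card {c, d, p, q} \<le> 4"
    by (simp add: card_insert_if)
  then have "2 \<le> card (V - {c, d, p, q})"
    using card diff_card_le_card_Diff[of "{c, d, p, q}" V] by simp
  then obtain R where "R \<subseteq> V - {c, d, p, q}" "card R = 2"
    using obtain_subset_with_card_n by metis
  then obtain a b where ab: "a \<noteq> b" "a \<in> V - {c, d, p, q}" "b \<in> V - {c, d, p, q}"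
    by (auto simp: card_2_iff)
  define u :: "'a \<Rightarrow> 'a \<Rightarrow> nat" where "u x y = of_bool ({x, y} \<in> U)" for x y
  define Q where "Q w x y z = u w x + u w y + u w z + u x y + u x z + u y z" for w x y z
  have quad: "even (Q w x y z)" if "distinct [w, x, y, z]" "{w, x, y, z} \<subseteq> V" for w x y z
    unfolding Q_def u_def using that by (intro even_card_quad even) (auto simp: nsets_def)
  have "c \<noteq> p" "c \<noteq> q" "d \<noteq> p" "d \<noteq> q"
    using disj cd(1) pq(1) by auto
  then have "even (Q a b c p)" "even (Q a b c q)" "even (Q a b d p)" "even (Q a b d q)"
    "even (Q c d p q)"
    using ab cd pq by (intro quad; auto)+
  \<comment> \<open>Modulo 2, the four quadruples through \<open>a, b\<close> sum to the 4-cycle \<open>c p d q\<close>, and adding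
    \<open>Q c d p q\<close> leaves only its diagonals.\<close>
  then have "even (Q a b c p + Q a b c q + Q a b d p + Q a b d q + Q c d p q)"
    by simp
  moreover have "Q a b c p + Q a b c q + Q a b d p + Q a b d q + Q c d p q =
    2 * (2 * u a b + u a c + u a d + u a p + u a q + u b c + u b d + u b p + u b q
      + u c p + u c q + u d p + u d q) + (u c d + u p q)"
    by (simp add: Q_def)
  ultimately have "even (u c d + u p q)"
    by (simp only: even_add dvd_triv_left)
  then show ?thesis
    by (simp add: u_def cd(1) pq(1) of_bool_def split: if_splits)
qed

text \<open>Intersecting pairs are compared through a third pair \<open>d\<close> disjoint from
  both, for which two vertices always remain.\<close>

lemma all_pairs_agree:
  assumes card: "6 \<le> card V"
    and even: "\<And>T. T \<in> nsets V 4 \<Longrightarrow> even (card (U \<inter> nsets T 2))"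
    and e: "e \<in> nsets V 2" and e': "e' \<in> nsets V 2"
  shows "e \<in> U \<longleftrightarrow> e' \<in> U"
proof (cases "e \<inter> e' = {}")
  case True
  then show ?thesis
    using disjoint_pairs_agree[OF card even e e'] by blast
next
  case False
  have fin: "finite e" "finite e'" and two: "card e = 2" "card e' = 2"
    using e e' by (auto simp: nsets_def)
  have "card (e \<union> e') \<le> 4"
    using card_Un_le[of e e'] two by simp
  then have "2 \<le> card (V - (e \<union> e'))"
    using card diff_card_le_card_Diff[of "e \<union> e'" V] fin by simp
  then obtain d where "d \<subseteq> V - (e \<union> e')" "card d = 2" "finite d"
    using obtain_subset_with_card_n by metis
  then have "d \<in> nsets V 2" "e \<inter> d = {}" "e' \<inter> d = {}"
    by (auto simp: nsets_def)
  then show ?thesis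
    using disjoint_pairs_agree[OF card even e, of d] disjoint_pairs_agree[OF card even e', of d]
    by simp
qed

theorem theorem2p5:
  fixes v k :: nat
    and V :: "'a set"
    and G G' :: "'a graph"
  assumes "4 \<le> k" and "k + 4 \<le> v"
    and "finite V" and "card V = v"
    and "is_graph G" and "verts G = V"
    and "is_graph G'" and "verts G' = V"
    and "hypomorphic_upto_complement k G G'"
  shows "G' = G \<or> G' = complement G"
proof -
  define U where "U = sym_diff (edges G) (edges G')"
  have odd_eq: "odd_quads G = odd_quads G'"
    using assms by (intro odd_quads_eq[of V]) auto
  have even: "even (card (U \<inter> nsets T 2))" if T: "T \<in> nsets V 4" for T
  proof -
    have fin: "finite (nsets T 2)"
      using T by (auto simp: nsets_def intro: finite_imp_finite_nsets)
    have "even (card (edges G \<inter> nsets T 2)) \<longleftrightarrow> even (card (edges G' \<inter> nsets T 2))"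
      using odd_eq T assms(6,8) by (auto simp: odd_quads_def)
    \<comment> \<open>Restriction to \<open>T\<close> commutes with symmetric difference, whose size
      has the parity of the sum of the two sizes.\<close>
    moreover have "U \<inter> nsets T 2 = sym_diff (edges G \<inter> nsets T 2) (edges G' \<inter> nsets T 2)"
      by (auto simp: U_def)
    ultimately show ?thesis
      using fin by (simp add: even_card_sym_diff_iff)
  qed
  \<comment> \<open>The bounds on \<open>k\<close> give \<open>8 \<le> v\<close>, so six vertices
    are available.\<close>
  have agree: "e \<in> U \<longleftrightarrow> e' \<in> U" if "e \<in> nsets V 2" "e' \<in> nsets V 2" for e e'
    using all_pairs_agree[OF _ even that] assms(1,2,4) by simp
  have sub: "edges G \<subseteq> nsets V 2" "edges G' \<subseteq> nsets V 2"
    using assms by (auto simp: is_graph_def)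
  show ?thesis
  \<comment> \<open>By \<open>agree\<close>, \<open>U\<close> contains either no pair or every pair.
    As both edge sets consist of pairs in \<open>V\<close>, these cases mean equal and complementary
    edge sets.\<close>
  proof (cases "nsets V 2 \<inter> U = {}")
    case True
    then have "edges G' = edges G"
      using sub by (auto simp: U_def)
    then show ?thesis
      using assms(6,8) by (simp add: prod_eq_iff)
  next
    case False
    then have "nsets V 2 \<subseteq> U"
      using agree by blast
    then have "edges G' = nsets V 2 - edges G"
      using sub by (auto simp: U_def)
    then show ?thesis
      using assms(6,8) by (simp add: prod_eq_iff complement_def)
  qed
qed

end
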